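(* Let $m\ge 1$, let $z_1,\dots,z_m\in\mathbb{C}_+$, and let $\Theta_\Delta$ be the interpolation L-system with nodes $z_1,\dots,z_m$. Then the dissipation coefficient of $\Theta_\Delta$ is $$\mathcal{D}(\Theta_\Delta)=1-\prod_{k=1}^m\frac{(\operatorname{Re}z_k)^2+(1-\operatorname{Im}z_k)^2}{(\operatorname{Re}z_k)^2+(1+\operatorname{Im}z_k)^2}.$$
   Context: $\mathbb{C}_+$ is the open upper half-plane. A scalar (canonical) L-system is an array $\Theta=\begin{pmatrix}T&K&1\\ \mathcal{H}&&\mathbb{C}\end{pmatrix}$, where $\mathcal{H}$ is a Hilbert space, $T$ is a bounded operator on $\mathcal{H}$, and $K:\mathbb{C}\to\mathcal{H}$ is linear with $\operatorname{Im}T:=\frac1{2i}(T-T^* )=KK^*$. Its transfer function is $W_\Theta(z)=1-2iK^*(T-zI)^{-1}K$, $z\in\rho(T)$. Its c-entropy is $\mathcal{S}(\Theta)=-\ln|W_\Theta(-i)|\in[0,+\infty]$, with $-\ln 0=+\infty$, and its dissipation coefficient is $\mathcal{D}(\Theta)=1-e^{-2\mathcal{S}(\Theta)}$ (with $e^{-\infty}=0$). For $z_1,\dots,z_m\in\mathbb{C}_+$ the interpolation L-system is $\Theta_\Delta=\begin{pmatrix}T_\Delta&K_\Delta&1\\ \mathbb{C}^m&&\mathbb{C}\end{pmatrix}$, where $T_\Delta$ is the upper triangular $m\times m$ matrix with diagonal entries $z_1,\dots,z_m$ and $(j,k)$ entry $2i\sqrt{\operatorname{Im}z_j\cdot\operatorname{Im}z_k}$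 for $j<k$ (zero for $j>k$), and $K_\Delta c=c\,g_\Delta$ with $g_\Delta=(\sqrt{\operatorname{Im}z_1},\dots,\sqrt{\operatorname{Im}z_m})^T$. Its transfer function is $W_{\Theta_\Delta}(z)=\prod_{k=1}^m\frac{z-\bar z_k}{z-z_k}$ (a known fact). *)

theory Defs
  imports "HOL-Analysis.Analysis"
begin

text \<open>
  Complex Hilbert spaces, built on top of the real ones: the real inner product is the real part of
  the complex one. The complex inner product is linear in its first argument.
\<close>

class complex_hilbert_space = real_inner + complete_space +
  fixes scaleC :: "complex \<Rightarrow> 'a \<Rightarrow> 'a"  (infixr "*\<^sub>C" 75)
    and cinner :: "'a \<Rightarrow> 'a \<Rightarrow> complex"
  assumes scaleC_add_right: "c *\<^sub>C (x + y) = c *\<^sub>C x + c *\<^sub>C y"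
    and scaleC_add_left: "(c + d) *\<^sub>C x = c *\<^sub>C x + d *\<^sub>C x"
    and scaleC_scaleC: "c *\<^sub>C d *\<^sub>C x = (c * d) *\<^sub>C x"
    and scaleC_of_real: "complex_of_real r *\<^sub>C x = r *\<^sub>R x"
    and cinner_commute: "cinner x y = cnj (cinner y x)"
    and cinner_add_left: "cinner (x + y) u = cinner x u + cinner y u"
    and cinner_scaleC_left: "cinner (c *\<^sub>C x) y = c * cinner x y"
    and Re_cinner: "Re (cinner x y) = x \<bullet> y"

instantiation complex :: complex_hilbert_space
begin

definition scaleC_complex :: "complex \<Rightarrow> complex \<Rightarrow> complex" where
  "scaleC_complex c x = c * x"

definition cinner_complex :: "complex \<Rightarrow> complex \<Rightarrow> complex" where
  "cinner_complex x y = x * cnj y"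

instance
  by standard
    (auto simp: scaleC_complex_def cinner_complex_def algebra_simps scaleR_conv_of_real
      inner_complex_def)

end

instantiation vec :: (complex_hilbert_space, finite) complex_hilbert_space
begin

definition scaleC_vec :: "complex \<Rightarrow> ('a, 'b) vec \<Rightarrow> ('a, 'b) vec" where
  "scaleC_vec c x = (\<chi> i. c *\<^sub>C (x $ i))"

definition cinner_vec :: "('a, 'b) vec \<Rightarrow> ('a, 'b) vec \<Rightarrow> complex" where
  "cinner_vec x y = (\<Sum>i\<in>UNIV. cinner (x $ i) (y $ i))"

instance
proof
  fix x y u :: "('a, 'b) vec" and c d :: complex and r :: real
  show "c *\<^sub>C (x + y) = c *\<^sub>C x + c *\<^sub>C y"
    by (simp add: scaleC_vec_def vec_eq_iff scaleC_add_right)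
  show "(c + d) *\<^sub>C x = c *\<^sub>C x + d *\<^sub>C x"
    by (simp add: scaleC_vec_def vec_eq_iff scaleC_add_left)
  show "c *\<^sub>C d *\<^sub>C x = (c * d) *\<^sub>C x"
    by (simp add: scaleC_vec_def vec_eq_iff scaleC_scaleC)
  show "complex_of_real r *\<^sub>C x = r *\<^sub>R x"
    by (simp add: scaleC_vec_def vec_eq_iff scaleC_of_real)
  show "cinner x y = cnj (cinner y x)"
    unfolding cinner_vec_def cnj_sum by (rule sum.cong[OF refl]) (rule cinner_commute)
  show "cinner (x + y) u = cinner x u + cinner y u"
    by (simp add: cinner_vec_def cinner_add_left sum.distrib)
  show "cinner (c *\<^sub>C x) y = c * cinner x y"
    by (simp add: cinner_vec_def scaleC_vec_def cinner_scaleC_left sum_distrib_left)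
  show "Re (cinner x y) = x \<bullet> y"
    by (simp add: cinner_vec_def inner_vec_def Re_cinner)
qed

end

definition clinear :: "('a::complex_hilbert_space \<Rightarrow> 'b::complex_hilbert_space) \<Rightarrow> bool" where
  "clinear A \<longleftrightarrow> (\<forall>x y. A (x + y) = A x + A y) \<and> (\<forall>c x. A (c *\<^sub>C x) = c *\<^sub>C A x)"

definition bounded_clinear ::
    "('a::complex_hilbert_space \<Rightarrow> 'b::complex_hilbert_space) \<Rightarrow> bool" where
  "bounded_clinear A \<longleftrightarrow> clinear A \<and> bounded_linear A"

text \<open>The adjoint exists and is unique for every bounded operator.\<close>

definition cadjoint ::
    "('a::complex_hilbert_space \<Rightarrow> 'b::complex_hilbert_space) \<Rightarrow> 'b \<Rightarrow> 'a" where
  "cadjoint A = (SOME B. \<forall>x y. cinner (A x) y = cinner x (B y))"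

definition im_part :: "('a::complex_hilbert_space \<Rightarrow> 'a) \<Rightarrow> 'a \<Rightarrow> 'a" where
  "im_part T = (\<lambda>x. (1 / (2 * \<i>)) *\<^sub>C (T x - cadjoint T x))"

definition resolvent_set :: "('a::complex_hilbert_space \<Rightarrow> 'a) \<Rightarrow> complex set" where
  "resolvent_set T = {z. bij (\<lambda>x. T x - z *\<^sub>C x) \<and> bounded_clinear (inv (\<lambda>x. T x - z *\<^sub>C x))}"

record 'a lsystem =
  state_op :: "'a \<Rightarrow> 'a"
  channel_op :: "complex \<Rightarrow> 'a"

definition is_lsystem :: "'a::complex_hilbert_space lsystem \<Rightarrow> bool" where
  "is_lsystem \<Theta> \<longleftrightarrow>
     bounded_clinear (state_op \<Theta>) \<and> clinear (channel_op \<Theta>) \<and>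
     im_part (state_op \<Theta>) = channel_op \<Theta> \<circ> cadjoint (channel_op \<Theta>)"

text \<open>
  The operator \<open>1 - 2 \<i> K\<^sup>* (T - z I)\<^sup>-\<^sup>1 K\<close> on the one-dimensional space of complex numbers is
  identified with its value at \<open>1\<close>.
\<close>

definition transfer_fun :: "'a::complex_hilbert_space lsystem \<Rightarrow> complex \<Rightarrow> complex" where
  "transfer_fun \<Theta> z =
     (if z \<in> resolvent_set (state_op \<Theta>)
      then 1 - 2 * \<i> * cadjoint (channel_op \<Theta>)
                         (inv (\<lambda>x. state_op \<Theta> x - z *\<^sub>C x) (channel_op \<Theta> 1))
      else undefined)"

definition c_entropy :: "'a::complex_hilbert_space lsystem \<Rightarrow> ereal" where
  "c_entropy \<Theta> =
     (if transfer_fun \<Theta> (- \<i>) = 0 then \<infinity> else ereal (- ln (cmod (transfer_fun \<Theta> (- \<i>)))))"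

definition dissipation_coeff :: "'a::complex_hilbert_space lsystem \<Rightarrow> real" where
  "dissipation_coeff \<Theta> =
     (if c_entropy \<Theta> = \<infinity> then 1 else 1 - exp (- 2 * real_of_ereal (c_entropy \<Theta>)))"

text \<open>
  The nodes are indexed by a finite linearly ordered type, whose order plays the role of the order
  of \<open>1, \<dots>, m\<close>; the state space is \<open>complex ^ 'm\<close>.
\<close>

definition interpolation_matrix :: "('m::{finite,linorder} \<Rightarrow> complex) \<Rightarrow> ((complex, 'm) vec, 'm) vec" where
  "interpolation_matrix z =
     (\<chi> j k. if j = k then z j
            else if j < k then 2 * \<i> * complex_of_real (sqrt (Im (z j) * Im (z k)))
            else 0)"

definition interpolation_vector :: "('m::{finite,linorder} \<Rightarrow> complex) \<Rightarrow> (complex, 'm) vec" where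
  "interpolation_vector z = (\<chi> j. complex_of_real (sqrt (Im (z j))))"

definition interpolation_lsystem ::
    "('m::{finite,linorder} \<Rightarrow> complex) \<Rightarrow> (complex, 'm) vec lsystem" where
  "interpolation_lsystem z =
     \<lparr> state_op = (\<lambda>x. interpolation_matrix z *v x),
       channel_op = (\<lambda>c. c *\<^sub>C interpolation_vector z) \<rparr>"

lemma cinner_add_right: "cinner x (y + u) = cinner x y + cinner x u"
  by (metis cinner_add_left cinner_commute complex_cnj_add)

lemma cinner_self_eq_0: "cinner x x = 0 \<Longrightarrow> x = 0"
  using Re_cinner[of x x] by simp

lemma cadjoint_eqI:
  assumes "\<And>x y. cinner (A x) y = cinner x (B y)"
  shows "cadjoint A = B"
proof -
  let ?C = "cadjoint A"
  have C: "\<forall>x y. cinner (A x) y = cinner x (?C y)"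
    unfolding cadjoint_def by (rule someI[of _ B]) (use assms in blast)
  have "?C y = B y" for y
  proof -
    have "cinner (?C y - B y) (?C y) = cinner (?C y - B y) (?C y - B y) + cinner (?C y - B y) (B y)"
      by (simp flip: cinner_add_right)
    moreover have "cinner (?C y - B y) (?C y) = cinner (?C y - B y) (B y)"
      using C assms by metis
    ultimately show ?thesis
      using cinner_self_eq_0[of "?C y - B y"] by simp
  qed
  then show ?thesis by blast
qed

lemma cadjoint_matrix:
  fixes M :: "complex ^ 'm ^ 'm"
  shows "cadjoint (\<lambda>x. M *v x) = (\<lambda>y. (\<chi> j. \<Sum>i\<in>UNIV. cnj (M $ i $ j) * y $ i))"
proof (rule cadjoint_eqI)
  fix x y :: "complex ^ 'm"
  have "cinner (M *v x) y = (\<Sum>i\<in>UNIV. \<Sum>j\<in>UNIV. M $ i $ j * x $ j * cnj (y $ i))"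
    by (simp add: cinner_vec_def cinner_complex_def matrix_vector_mult_def sum_distrib_right)
  also have "\<dots> = (\<Sum>j\<in>UNIV. \<Sum>i\<in>UNIV. M $ i $ j * x $ j * cnj (y $ i))"
    by (rule sum.swap)
  also have "\<dots> = cinner x (\<chi> j. \<Sum>i\<in>UNIV. cnj (M $ i $ j) * y $ i)"
    by (simp add: cinner_vec_def cinner_complex_def sum_distrib_left mult_ac)
  finally show "cinner (M *v x) y = cinner x (\<chi> j. \<Sum>i\<in>UNIV. cnj (M $ i $ j) * y $ i)" .
qed

lemma cadjoint_channel:
  fixes g :: "'a::complex_hilbert_space"
  shows "cadjoint (\<lambda>c. c *\<^sub>C g) = (\<lambda>x. cinner x g)"
proof (rule cadjoint_eqI)
  fix c :: complex and x :: 'a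
  show "cinner (c *\<^sub>C g) x = cinner c (cinner x g)"
    using cinner_commute[of g x] by (simp add: cinner_scaleC_left cinner_complex_def)
qed

lemma is_lsystem_interpolation_lsystem:
  fixes z :: "'m::{finite,linorder} \<Rightarrow> complex"
  assumes pos: "\<And>k. Im (z k) > 0"
  shows "is_lsystem (interpolation_lsystem z)"
proof -
  let ?M = "interpolation_matrix z" and ?g = "interpolation_vector z"
  have lin: "clinear (\<lambda>x. ?M *v x)"
    by (auto simp: clinear_def matrix_vector_right_distrib vec_eq_iff scaleC_vec_def
        scaleC_complex_def matrix_vector_mult_def sum_distrib_left sum.distrib algebra_simps)
  have bnd: "bounded_linear (\<lambda>x. ?M *v x)"
  proof (rule linear_conv_bounded_linear[THEN iffD1], rule linearI)
    fix x y and r :: real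
    show "?M *v (x + y) = ?M *v x + ?M *v y"
      by (rule matrix_vector_right_distrib)
    show "?M *v (r *\<^sub>R x) = r *\<^sub>R (?M *v x)"
      using lin unfolding clinear_def by (metis scaleC_of_real)
  qed
  have chan: "clinear (\<lambda>c. c *\<^sub>C ?g)"
    by (auto simp: clinear_def scaleC_add_left scaleC_scaleC scaleC_complex_def[abs_def])
  have entry: "1 / (2 * \<i>) * (?M $ i $ j - cnj (?M $ j $ i))
      = complex_of_real (sqrt (Im (z i)) * sqrt (Im (z j)))" for i j
  proof (cases i j rule: linorder_cases)
    case equal
    have "z i - cnj (z i) = 2 * \<i> * complex_of_real (Im (z i))"
      by (simp add: complex_eq_iff)
    then show ?thesis
      using equal pos[of i] by (simp add: interpolation_matrix_def)
  qed (auto simp: interpolation_matrix_def real_sqrt_mult mult_ac)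
  have "im_part (\<lambda>x. ?M *v x) x = cinner x ?g *\<^sub>C ?g" for x
  proof -
    have "im_part (\<lambda>x. ?M *v x) x $ i = (cinner x ?g *\<^sub>C ?g) $ i" for i
    proof -
      have "im_part (\<lambda>x. ?M *v x) x $ i
          = 1 / (2 * \<i>) * (\<Sum>j\<in>UNIV. (?M $ i $ j - cnj (?M $ j $ i)) * x $ j)"
        unfolding im_part_def cadjoint_matrix
        by (simp add: scaleC_vec_def scaleC_complex_def matrix_vector_mult_def left_diff_distrib
            sum_subtractf)
      also have "\<dots> = (\<Sum>j\<in>UNIV. 1 / (2 * \<i>) * (?M $ i $ j - cnj (?M $ j $ i)) * x $ j)"
        unfolding sum_distrib_left mult.assoc ..
      also have "\<dots> = (\<Sum>j\<in>UNIV. complex_of_real (sqrt (Im (z i)) * sqrt (Im (z j))) * x $ j)"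
        unfolding entry ..
      also have "\<dots> = (cinner x ?g *\<^sub>C ?g) $ i"
        by (simp add: interpolation_vector_def cinner_vec_def cinner_complex_def scaleC_vec_def
            scaleC_complex_def sum_distrib_left sum_distrib_right mult_ac)
      finally show ?thesis .
    qed
    then show ?thesis by (simp add: vec_eq_iff)
  qed
  then have "im_part (\<lambda>x. ?M *v x) = (\<lambda>c. c *\<^sub>C ?g) \<circ> cadjoint (\<lambda>c. c *\<^sub>C ?g)"
    by (simp add: cadjoint_channel fun_eq_iff)
  with lin bnd chan show ?thesis
    by (simp add: is_lsystem_def interpolation_lsystem_def bounded_clinear_def)
qed

end

theory Submission
  imports Defs
begin

text \<open>
  For every L-system, \<open>exp (- 2 S)\<close> is the squared modulus of the transfer function at \<open>- \<i>\<close>, so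
  everything rests on the product formula for the transfer function \<open>W\<close> of the interpolation system.

  Put \<open>s\<^sub>j = sqrt (Im z\<^sub>j)\<close>, fix \<open>w\<close> outside the diagonal entries, and let
  \<open>b\<^sub>k = (w - cnj z\<^sub>k) / (w - z\<^sub>k)\<close> be the factor contributed by the node \<open>z\<^sub>k\<close>. The vector
  \<open>x = (T - w)\<^sup>-\<^sup>1 g\<close> solves the triangular system
  \<open>(z\<^sub>j - w) x\<^sub>j = s\<^sub>j (1 - 2 \<i> (\<Sum>k>j. s\<^sub>k x\<^sub>k))\<close>.
  The bracket is the transfer function of the part of the system that lies beyond \<open>j\<close>, which suggests
  the back substitution \<open>x\<^sub>j = s\<^sub>j (\<Prod>k>j. b\<^sub>k) / (z\<^sub>j - w)\<close>. Since
  \<open>2 \<i> s\<^sub>k\<^sup>2 / (z\<^sub>k - w) = 1 - b\<^sub>k\<close>, the sum \<open>2 \<i> (\<Sum>k>j. s\<^sub>k x\<^sub>k)\<close> telescopes to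
  \<open>1 - (\<Prod>k>j. b\<^sub>k)\<close>, which confirms the guess; the same telescoping over all indices gives
  \<open>W w = (\<Prod>k. b\<^sub>k)\<close>. At \<open>w = - \<i>\<close> the squared modulus of \<open>b\<^sub>k\<close> is the factor in the theorem.
\<close>

lemma dissipation_coeff_eq_transfer_fun:
  "dissipation_coeff \<Theta> = 1 - (cmod (transfer_fun \<Theta> (- \<i>)))\<^sup>2"
  by (auto simp: dissipation_coeff_def c_entropy_def exp_double)

text \<open>
  Expand the complement of a product by the least index: each summand is the loss at \<open>k\<close> of what has
  passed all larger indices, and what is not lost at any index is the full product.
\<close>

lemma sum_one_minus_prod_greater_telescope:
  fixes b :: "'a::linorder \<Rightarrow> 'b::comm_ring_1"
  assumes "finite A"
  shows "(\<Sum>k\<in>A. (1 - b k) * (\<Prod>l\<in>{l\<in>A. k < l}. b l)) = 1 - (\<Prod>k\<in>A. b k)"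
  using assms
proof (induction rule: finite_linorder_min_induct)
  case empty
  show ?case by simp
next
  case (insert a A)
  have "a \<notin> A"
    using insert.hyps by auto
  have "{l \<in> insert a A. a < l} = A"
    using insert.hyps by auto
  moreover have "{l \<in> insert a A. k < l} = {l \<in> A. k < l}" if "k \<in> A" for k
    using insert.hyps that by (auto dest: less_asym)
  ultimately have "(\<Sum>k\<in>insert a A. (1 - b k) * (\<Prod>l\<in>{l \<in> insert a A. k < l}. b l))
      = (1 - b a) * (\<Prod>l\<in>A. b l) + (\<Sum>k\<in>A. (1 - b k) * (\<Prod>l\<in>{l \<in> A. k < l}. b l))"
    using insert.hyps \<open>a \<notin> A\<close> by simp
  then show ?case
    using insert \<open>a \<notin> A\<close> by (simp add: algebra_simps)
qed

text \<open>In finite dimension an eigenvalue is the only obstruction to membership in the resolvent set.\<close>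

lemma mem_resolvent_set_if_kernel_trivial:
  fixes T :: "complex ^ 'm \<Rightarrow> complex ^ 'm"
  assumes T: "clinear T"
    and ker: "\<And>x. T x = w *\<^sub>C x \<Longrightarrow> x = 0"
  shows "w \<in> resolvent_set T"
proof -
  let ?R = "\<lambda>x. T x - w *\<^sub>C x"
  have add: "?R (x + y) = ?R x + ?R y" for x y
    using T by (simp add: clinear_def scaleC_add_right)
  have scale: "?R (c *\<^sub>C x) = c *\<^sub>C ?R x" for c x
  proof -
    have "T (c *\<^sub>C x) = c *\<^sub>C T x"
      using T by (simp add: clinear_def)
    then show ?thesis
      by (simp add: scaleC_vec_def scaleC_complex_def vec_eq_iff algebra_simps)
  qed
  have lin: "linear ?R"
    by (rule linearI) (rule add, rule scale[of "complex_of_real _", unfolded scaleC_of_real])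
  have inj: "inj ?R"
    unfolding linear_injective_0[OF lin] using ker by simp
  have bij: "bij ?R"
    using inj linear_injective_imp_surjective[OF lin inj] by (simp add: bij_def)
  have R_inv: "?R (inv ?R y) = y" for y
    using bij by (rule surj_f_inv_f[OF bij_is_surj])
  have inv_R: "inv ?R (?R x) = x" for x
    using inj by (rule inv_f_f)
  have inv_add: "inv ?R (x + y) = inv ?R x + inv ?R y" for x y
    using inv_R[of "inv ?R x + inv ?R y"] unfolding add R_inv .
  have inv_scale: "inv ?R (c *\<^sub>C x) = c *\<^sub>C inv ?R x" for c x
    using inv_R[of "c *\<^sub>C inv ?R x"] unfolding scale R_inv .
  have "linear (inv ?R)"
    by (rule linearI)
      (rule inv_add, rule inv_scale[of "complex_of_real _", unfolded scaleC_of_real])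
  then have "bounded_clinear (inv ?R)"
    using inv_add inv_scale
    by (simp add: bounded_clinear_def clinear_def linear_conv_bounded_linear)
  with bij show ?thesis
    by (simp add: resolvent_set_def)
qed

lemma interpolation_matrix_mult_component:
  "(interpolation_matrix z *v x) $ j
    = z j * x $ j + 2 * \<i> * complex_of_real (sqrt (Im (z j)))
        * (\<Sum>k\<in>{j<..}. complex_of_real (sqrt (Im (z k))) * x $ k)"
proof -
  have "(interpolation_matrix z *v x) $ j
      = (\<Sum>k\<in>UNIV. (if k = j then z j * x $ j else 0)
          + (if k \<in> {j<..} then 2 * \<i> * complex_of_real (sqrt (Im (z j)))
              * (complex_of_real (sqrt (Im (z k))) * x $ k) else 0))"
    by (auto simp: interpolation_matrix_def matrix_vector_mult_def real_sqrt_mult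
        intro!: sum.cong)
  also have "\<dots> = z j * x $ j + (\<Sum>k\<in>{j<..}. 2 * \<i> * complex_of_real (sqrt (Im (z j)))
              * (complex_of_real (sqrt (Im (z k))) * x $ k))"
    by (simp add: sum.distrib sum.If_cases greaterThan_def)
  finally show ?thesis
    by (simp add: sum_distrib_left)
qed

lemma clinear_state_op_interpolation_lsystem:
  "clinear (state_op (interpolation_lsystem z))"
  by (auto simp: interpolation_lsystem_def clinear_def matrix_vector_right_distrib vec_eq_iff
      scaleC_vec_def scaleC_complex_def matrix_vector_mult_def sum_distrib_left sum.distrib algebra_simps)

text \<open>
  By triangularity, the last nonzero entry of an eigenvector forces the eigenvalue to be the diagonal
  entry at that index.
\<close>

lemma mem_resolvent_set_interpolation_lsystem:
  fixes z :: "'m::{finite,linorder} \<Rightarrow> complex"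
  assumes w: "\<And>k. z k \<noteq> w"
  shows "w \<in> resolvent_set (state_op (interpolation_lsystem z))"
proof (rule mem_resolvent_set_if_kernel_trivial[OF clinear_state_op_interpolation_lsystem])
  fix x :: "(complex, 'm) vec"
  assume "state_op (interpolation_lsystem z) x = w *\<^sub>C x"
  then have eig: "(interpolation_matrix z *v x) $ j = w * x $ j" for j
    by (simp add: interpolation_lsystem_def scaleC_vec_def scaleC_complex_def)
  show "x = 0"
  proof (rule ccontr)
    assume "x \<noteq> 0"
    define j where "j = Max {k. x $ k \<noteq> 0}"
    have "{k. x $ k \<noteq> 0} \<noteq> {}"
      using \<open>x \<noteq> 0\<close> by (auto simp: vec_eq_iff)
    then have "x $ j \<noteq> 0"
      using Max_in[of "{k. x $ k \<noteq> 0}"] by (simp add: j_def)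
    have "x $ k = 0" if "j < k" for k
    proof (rule ccontr)
      assume "x $ k \<noteq> 0"
      then have "k \<le> j"
        unfolding j_def by (intro Max_ge) auto
      with that show False
        by simp
    qed
    then have "z j * x $ j = w * x $ j"
      using eig[of j] by (simp add: interpolation_matrix_mult_component)
    with \<open>x $ j \<noteq> 0\<close> w show False
      by simp
  qed
qed

text \<open>
  Back substitution: the resolvent vector at \<open>j\<close> carries the factors of the nodes beyond \<open>j\<close>, and both
  the triangular system and its readout through the channel are instances of one telescoping sum.
\<close>

lemma transfer_fun_interpolation_lsystem:
  fixes z :: "'m::{finite,linorder} \<Rightarrow> complex"
  assumes pos: "\<And>k. Im (z k) > 0"
    and w: "\<And>k. z k \<noteq> w"
  shows "transfer_fun (interpolation_lsystem z) w = (\<Prod>k\<in>UNIV. (w - cnj (z k)) / (w - z k))"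
proof -
  let ?T = "state_op (interpolation_lsystem z)"
  let ?g = "interpolation_vector z"
  let ?R = "\<lambda>x. ?T x - w *\<^sub>C x"
  define s where "s k = complex_of_real (sqrt (Im (z k)))" for k
  define b where "b k = (w - cnj (z k)) / (w - z k)" for k
  define x where "x = (\<chi> j. s j * (\<Prod>l\<in>{j<..}. b l) / (z j - w))"
  have s_sq: "s k * s k = complex_of_real (Im (z k))" for k
    using pos[of k] by (simp add: s_def flip: of_real_mult)
  have loss: "2 * \<i> * (s k * s k) / (z k - w) = 1 - b k" for k
  proof -
    have "2 * \<i> * (s k * s k) = z k - cnj (z k)"
      by (simp add: s_sq complex_eq_iff)
    then show ?thesis
      using w[of k] by (simp add: b_def divide_simps) (simp add: algebra_simps)
  qed
  have readout: "2 * \<i> * (\<Sum>k\<in>A. s k * x $ k) = 1 - (\<Prod>k\<in>A. b k)"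
    if up: "\<And>k. k \<in> A \<Longrightarrow> {k<..} \<subseteq> A" for A
  proof -
    have "2 * \<i> * (\<Sum>k\<in>A. s k * x $ k) = (\<Sum>k\<in>A. (1 - b k) * (\<Prod>l\<in>{k<..}. b l))"
      unfolding sum_distrib_left loss[symmetric] by (simp add: x_def mult_ac)
    also have "\<dots> = (\<Sum>k\<in>A. (1 - b k) * (\<Prod>l\<in>{l\<in>A. k < l}. b l))"
    proof (rule sum.cong[OF refl])
      fix k
      assume "k \<in> A"
      then have "{k<..} = {l\<in>A. k < l}"
        using up by auto
      then show "(1 - b k) * (\<Prod>l\<in>{k<..}. b l) = (1 - b k) * (\<Prod>l\<in>{l\<in>A. k < l}. b l)"
        by simp
    qed
    also have "\<dots> = 1 - (\<Prod>k\<in>A. b k)"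
      by (rule sum_one_minus_prod_greater_telescope) simp
    finally show ?thesis .
  qed
  have "?R x $ j = ?g $ j" for j
  proof -
    have "?R x $ j = (z j - w) * x $ j + s j * (2 * \<i> * (\<Sum>k\<in>{j<..}. s k * x $ k))"
      by (simp add: interpolation_lsystem_def interpolation_matrix_mult_component scaleC_vec_def
          scaleC_complex_def s_def algebra_simps)
    also have "\<dots> = (z j - w) * x $ j + s j * (1 - (\<Prod>k\<in>{j<..}. b k))"
      by (subst readout) auto
    also have "(z j - w) * x $ j = s j * (\<Prod>k\<in>{j<..}. b k)"
      using w[of j] by (simp add: x_def)
    finally show ?thesis
      by (simp add: interpolation_vector_def s_def algebra_simps)
  qed
  then have "?R x = ?g"
    by (simp add: vec_eq_iff)
  have res: "w \<in> resolvent_set ?T"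
    using w by (rule mem_resolvent_set_interpolation_lsystem)
  then have "inj ?R"
    by (simp add: resolvent_set_def bij_def)
  then have "inv ?R ?g = x"
    using \<open>?R x = ?g\<close> by (rule inv_f_eq)
  moreover have "channel_op (interpolation_lsystem z) = (\<lambda>c. c *\<^sub>C ?g)"
    by (simp add: interpolation_lsystem_def)
  moreover have "1 *\<^sub>C ?g = ?g"
    by (simp add: scaleC_vec_def scaleC_complex_def vec_eq_iff)
  ultimately have "transfer_fun (interpolation_lsystem z) w = 1 - 2 * \<i> * cinner x ?g"
    using res by (simp add: transfer_fun_def cadjoint_channel)
  also have "cinner x ?g = (\<Sum>k\<in>UNIV. s k * x $ k)"
    by (simp add: cinner_vec_def cinner_complex_def interpolation_vector_def s_def mult_ac)
  also have "1 - 2 * \<i> * \<dots> = (\<Prod>k\<in>UNIV. b k)"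
    by (subst readout) auto
  finally show ?thesis
    by (simp add: b_def)
qed

theorem theorem9:
  fixes z :: "'m::{finite,linorder} \<Rightarrow> complex"
  assumes "\<And>k. Im (z k) > 0"
  shows "dissipation_coeff (interpolation_lsystem z) =
    1 - (\<Prod>k\<in>UNIV. ((Re (z k))\<^sup>2 + (1 - Im (z k))\<^sup>2) / ((Re (z k))\<^sup>2 + (1 + Im (z k))\<^sup>2))"
proof -
  have "z k \<noteq> - \<i>" for k
    using assms[of k] by auto
  then have W: "transfer_fun (interpolation_lsystem z) (- \<i>)
      = (\<Prod>k\<in>UNIV. (- \<i> - cnj (z k)) / (- \<i> - z k))"
    using assms by (intro transfer_fun_interpolation_lsystem)
  have factor: "(cmod ((- \<i> - cnj c) / (- \<i> - c)))\<^sup>2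
      = ((Re c)\<^sup>2 + (1 - Im c)\<^sup>2) / ((Re c)\<^sup>2 + (1 + Im c)\<^sup>2)" for c
    unfolding norm_divide power_divide cmod_power2 by (simp add: power2_eq_square algebra_simps)
  show ?thesis
    unfolding dissipation_coeff_eq_transfer_fun W prod_norm[symmetric] prod_power_distrib factor ..
qed

end
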